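(* Let $\tilde\delta$ be an $n$-variate normally distributed random vector with mean $\mathbf{0}$ and invertible covariance matrix $\Sigma\in\mathbb{R}^{n\times n}$ with $\Sigma_{ii}=1$ for all $i\in[n]$. Let $E$ be the edge set of an undirected graph on $[n]$. Given $p\in(0,1)$, set $\alpha=\frac{p}{|E|+n}$ and let $\gamma^Z_{ij}=Z_{1-\alpha/2}\,\|\Sigma^{1/2}e_{ij}\|$ for all $i,j\in[n]$ such that $\{i,j\}\in E$ or $i=j$, where $Z_{1-\alpha/2}$ is the $1-\alpha/2$ quantile of the standard normal distribution. Then the set $$\mathcal{U}^Z_{\mathcal S}=\{\delta\in\mathbb{R}^n : |\delta_i|\le\gamma^Z_{ii}\ \forall i\in[n],\ |\delta_i-\delta_j|\le\gamma^Z_{ij}\ \forall \{i,j\}\in E\}$$ satisfies $\mathbb{P}(\tilde\delta\in\mathcal{U}^Z_{\mathcal S})\ge 1-p$.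
   Context: $[n]=\{1,\dots,n\}$; $\|\cdot\|$ is the Euclidean norm; $\Sigma^{1/2}$ is the symmetric positive definite square root of $\Sigma$. With $e_i$ the standard unit vectors of $\mathbb{R}^n$, $e_{ij}=e_i-e_j$ if $i\ne j$ and $e_{ii}=e_i$. Edges of the graph join distinct vertices; $|E|$ counts undirected edges. *)

theory Defs
  imports "HOL-Probability.Probability"
begin

text \<open>A random vector is normally distributed if its law is the law of an affine image
  \<open>m + A Z\<close> of a vector \<open>Z\<close> of independent standard normal variables. This includes the
  degenerate laws (\<open>A\<close> singular). No generality is lost by letting \<open>Z\<close> have the same dimension
  as \<open>X\<close>.\<close>

definition normal_vector :: "'a measure \<Rightarrow> ('a \<Rightarrow> real ^ 'n) \<Rightarrow> bool" where
  "normal_vector M X \<longleftrightarrow> X \<in> borel_measurable M \<and>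
     (\<exists>(m :: real ^ 'n) (A :: real ^ 'n ^ 'n).
        distr M borel X =
        distr (Pi\<^sub>M UNIV (\<lambda>_. std_normal_distribution)) borel (\<lambda>z. m + A *v (\<chi> i. z i)))"

text \<open>The Bochner integrals below are only meaningful if the integrands are integrable (otherwise
  they are 0 by convention); this is the case for every normally distributed vector.\<close>

definition mean_vector :: "'a measure \<Rightarrow> ('a \<Rightarrow> real ^ 'n) \<Rightarrow> real ^ 'n" where
  "mean_vector M X = (\<chi> i. integral\<^sup>L M (\<lambda>\<omega>. X \<omega> $ i))"

definition covariance_matrix :: "'a measure \<Rightarrow> ('a \<Rightarrow> real ^ 'n) \<Rightarrow> real ^ 'n ^ 'n" where
  "covariance_matrix M X =
     (\<chi> i j. integral\<^sup>L M (\<lambda>\<omega>. (X \<omega> $ i - mean_vector M X $ i) * (X \<omega> $ j - mean_vector M X $ j)))"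

definition sym_pos_def :: "real ^ 'n ^ 'n \<Rightarrow> bool" where
  "sym_pos_def A \<longleftrightarrow> transpose A = A \<and> (\<forall>x. x \<noteq> 0 \<longrightarrow> x \<bullet> (A *v x) > 0)"

text \<open>Well defined for symmetric positive definite matrices, hence for every invertible
  covariance matrix.\<close>

definition matrix_sqrt :: "real ^ 'n ^ 'n \<Rightarrow> real ^ 'n ^ 'n" where
  "matrix_sqrt S = (THE B. sym_pos_def B \<and> B ** B = S)"

definition quantile :: "real measure \<Rightarrow> real \<Rightarrow> real" where
  "quantile \<mu> q = Inf {x. q \<le> cdf \<mu> x}"

definition e_vec :: "'n \<Rightarrow> 'n \<Rightarrow> real ^ 'n" where
  "e_vec i j = (if i = j then axis i 1 else axis i 1 - axis j 1)"

end

theory Submission imports Defs begin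

text \<open>Every constraint of the uncertainty set has the form \<open>\<bar>c \<bullet> X\<bar> \<le> z * norm (matrix_sqrt \<Sigma> *v c)\<close>
  for a direction \<open>c = axis i 1\<close> or \<open>c = axis i 1 - axis j 1\<close>, with \<open>z\<close> the \<open>1 - \<alpha> / 2\<close> quantile. There are
  \<open>CARD('n) + card E\<close> directions up to sign, so by the union bound it is enough that each
  constraint fails with probability at most \<open>\<alpha>\<close>.

  This holds because \<open>c \<bullet> X\<close> is a centred normal variable whose standard deviation is exactly
  \<open>norm (matrix_sqrt \<Sigma> *v c)\<close>. Indeed \<open>X\<close> has the law of \<open>A Z\<close> with independent standard normal
  coordinates \<open>Z\<close> and \<open>\<Sigma> = A ** transpose A\<close> (\<open>covariance_of_centered_normal\<close>), so \<open>c \<bullet> X\<close> has variance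
  \<open>c \<bullet> (\<Sigma> *v c)\<close> (\<open>normal_vector_linear_form\<close>), which is the squared norm of \<open>matrix_sqrt \<Sigma> *v c\<close>
  (\<open>norm_matrix_sqrt\<close>). Dividing by the standard deviation reduces the claim to the two-sided tail of
  the standard normal law (\<open>std_normal_two_sided_tail\<close>).

  As \<open>matrix_sqrt\<close> is a definite description, its use requires that \<open>\<Sigma>\<close> has exactly one symmetric
  positive definite square root. Existence comes from the polar decomposition of \<open>A\<close>, found by
  maximising \<open>trace (A ** U)\<close> over the compact set of orthogonal matrices \<open>U\<close>
  (\<open>sym_pos_def_root_exists\<close>), and uniqueness from a trace identity
  (\<open>sym_pos_def_root_unique\<close>).\<close>

section \<open>Rank-one matrices and reflections\<close>

definition outer :: "real ^ 'n \<Rightarrow> real ^ 'n \<Rightarrow> real ^ 'n ^ 'n" where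
  "outer u v = (\<chi> i j. u $ i * v $ j)"

lemma matrix_mult_outer: "A ** outer u v = outer (A *v u) v"
  by (simp add: outer_def matrix_matrix_mult_def matrix_vector_mult_def vec_eq_iff
      sum_distrib_right mult.assoc)

lemma outer_mult_vector: "outer u v *v x = (v \<bullet> x) *\<^sub>R u"
  by (simp add: outer_def matrix_vector_mult_def vec_eq_iff inner_vec_def
      sum_distrib_right mult_ac sum_distrib_left)

lemma trace_outer: "trace (outer u v) = u \<bullet> v"
  by (simp add: trace_def outer_def inner_vec_def)

lemma matrix_diff_ldistrib: "(A :: real ^ 'n ^ 'n) ** (B - C) = A ** B - A ** C"
  by (simp add: matrix_matrix_mult_def vec_eq_iff right_diff_distrib sum_subtractf)

lemma matrix_diff_rdistrib: "((A :: real ^ 'n ^ 'n) - B) ** C = A ** C - B ** C"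
  by (simp add: matrix_matrix_mult_def vec_eq_iff left_diff_distrib sum_subtractf)

text \<open>For a unit vector \<open>u\<close> this is the reflection in the hyperplane orthogonal to \<open>u\<close>.\<close>

definition householder :: "real ^ 'n \<Rightarrow> real ^ 'n ^ 'n" where
  "householder u = mat 1 - outer (2 *\<^sub>R u) u"

lemma matrix_mult_householder:
  "(P :: real ^ 'n ^ 'n) ** householder u = P - outer (2 *\<^sub>R (P *v u)) u"
  by (simp add: householder_def matrix_diff_ldistrib matrix_mult_outer matrix_vector_mult_scaleR)

lemma orthogonal_matrix_householder:
  assumes "u \<bullet> u = 1"
  shows "orthogonal_matrix (householder u)"
proof -
  have t: "transpose (householder u) = householder u"
    by (simp add: householder_def outer_def transpose_def vec_eq_iff mat_def mult.commute)
  have v: "householder u *v u = - u"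
    using assms
    by (simp add: householder_def matrix_vector_mult_diff_rdistrib
        outer_mult_vector scaleR_2)
  have "householder u ** householder u = householder u - outer (2 *\<^sub>R (- u)) u"
    by (simp add: matrix_mult_householder v)
  also have "\<dots> = mat 1"
    by (simp add: householder_def outer_def vec_eq_iff)
  finally show ?thesis
    by (simp add: orthogonal_matrix t)
qed

lemma trace_mult_householder:
  "trace ((P :: real ^ 'n ^ 'n) ** householder u) = trace P - 2 * ((P *v u) \<bullet> u)"
  by (simp add: matrix_mult_householder trace_sub trace_outer)

section \<open>The positive definite square root\<close>

text \<open>Compactness supplies the maximiser from which the positive definite square root is built.\<close>

lemma compact_orthogonal_matrices: "compact {Q :: real ^ 'n ^ 'n. orthogonal_matrix Q}"
proof -
  have "closed {Q :: real ^ 'n ^ 'n. (\<chi> i j. \<Sum>k\<in>UNIV. Q $ k $ i * Q $ k $ j) = mat 1}"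
    by (intro closed_Collect_eq continuous_intros)
  also have "{Q :: real ^ 'n ^ 'n. (\<chi> i j. \<Sum>k\<in>UNIV. Q $ k $ i * Q $ k $ j) = mat 1}
      = {Q. orthogonal_matrix Q}"
    by (simp add: orthogonal_matrix matrix_matrix_mult_def transpose_def)
  finally have cl: "closed {Q :: real ^ 'n ^ 'n. orthogonal_matrix Q}" .
  have "norm Q \<le> real CARD('n)" if "orthogonal_matrix Q" for Q :: "real ^ 'n ^ 'n"
  proof -
    have "norm (Q $ i) = 1" for i
      using that by (simp add: orthogonal_matrix_orthonormal_rows row_def)
    moreover have "norm Q \<le> (\<Sum>i\<in>UNIV. norm (Q $ i))"
      unfolding norm_vec_def[of Q] by (rule L2_set_le_sum) simp
    ultimately show ?thesis by simp
  qed
  then show ?thesis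
    using cl by (auto simp: compact_eq_bounded_closed bounded_iff)
qed

text \<open>First-order optimality on the orthogonal group, tested on reflections only. One reflection
  along \<open>u\<close> lowers the trace by twice \<open>u \<bullet> P u\<close>, so this number cannot be negative. The product of
  two reflections is a rotation in the plane of their normals; if the normals are close to each
  other, the rotation is small and the first-order change of the trace is given by the antisymmetric
  part of \<open>P\<close> in that plane, which must therefore vanish.\<close>

lemma trace_maximal_imp_symmetric_psd:
  fixes P :: "real ^ 'n ^ 'n"
  assumes max: "\<And>Q. orthogonal_matrix Q \<Longrightarrow> trace (P ** Q) \<le> trace P"
  shows "transpose P = P" and "0 \<le> x \<bullet> (P *v x)"
proof -
  have psd_unit: "0 \<le> (P *v u) \<bullet> u" if "u \<bullet> u = 1" for u
    using max[OF orthogonal_matrix_householder[OF that]] by (simp add: trace_mult_householder)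
  show "0 \<le> x \<bullet> (P *v x)"
  proof (cases "x = 0")
    case False
    then have "0 \<le> (P *v (x /\<^sub>R norm x)) \<bullet> (x /\<^sub>R norm x)"
      by (intro psd_unit) (simp add: dot_square_norm power2_eq_square)
    then have "0 \<le> (inverse (norm x) * inverse (norm x)) * ((P *v x) \<bullet> x)"
      by (simp add: matrix_vector_mult_scaleR mult.assoc)
    moreover have "0 < inverse (norm x) * inverse (norm x)" using False by simp
    ultimately show ?thesis
      by (simp add: zero_le_mult_iff inner_commute)
  qed simp
  \<comment> \<open>The test rotation is the product of the reflections along \<open>u\<close> and \<open>v = w /\<^sub>R norm w\<close>. Scaling by
    \<open>w \<bullet> w\<close> makes both sides polynomial in \<open>w\<close>.\<close>
  have two: "2 * (u \<bullet> w) * ((P *v u) \<bullet> w) \<le> (P *v u) \<bullet> u * (w \<bullet> w) + (P *v w) \<bullet> w"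
    if u: "u \<bullet> u = 1" and w0: "w \<noteq> 0" for u w
  proof -
    define v where "v = w /\<^sub>R norm w"
    have v: "v \<bullet> v = 1" using w0 by (simp add: v_def dot_square_norm power2_eq_square)
    have "trace (P ** (householder u ** householder v)) \<le> trace P"
      by (intro max orthogonal_matrix_mul orthogonal_matrix_householder u v)
    then have "trace ((P ** householder u) ** householder v) \<le> trace P"
      by (simp add: matrix_mul_assoc)
    then have "2 * (u \<bullet> v) * ((P *v u) \<bullet> v) \<le> (P *v u) \<bullet> u + (P *v v) \<bullet> v"
      by (simp add: trace_mult_householder[of _ v] trace_sub trace_outer matrix_mult_householder[of P u]
          matrix_vector_mult_diff_rdistrib outer_mult_vector
          inner_diff_left)
    then have "(w \<bullet> w) * (2 * (u \<bullet> v) * ((P *v u) \<bullet> v)) \<le> (w \<bullet> w) * ((P *v u) \<bullet> u + (P *v v) \<bullet> v)"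
      by (intro mult_left_mono) simp_all
    moreover obtain r where w: "w = r *\<^sub>R v" and ww: "w \<bullet> w = r\<^sup>2"
      using w0 that[of "norm w"] by (simp add: v_def dot_square_norm)
    have "(w \<bullet> w) * (2 * (u \<bullet> v) * ((P *v u) \<bullet> v)) = 2 * (u \<bullet> w) * ((P *v u) \<bullet> w)"
      unfolding ww by (simp add: w power2_eq_square)
    moreover have "(w \<bullet> w) * ((P *v v) \<bullet> v) = (P *v w) \<bullet> w"
      unfolding ww by (simp add: w power2_eq_square matrix_vector_mult_scaleR)
    ultimately show ?thesis by (simp add: algebra_simps)
  qed
  \<comment> \<open>With normals \<open>axis i 1\<close> and \<open>axis i 1 + t *\<^sub>R axis j 1\<close> the inequality just shown becomes
    \<open>t * (P $ j $ i - P $ i $ j) \<le> t\<^sup>2 * (P $ i $ i + P $ j $ j)\<close>; let \<open>t\<close> tend to 0 from above.\<close>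
  have le: "P $ j $ i \<le> P $ i $ j" if ij: "i \<noteq> j" for i j
  proof (rule field_le_epsilon)
    fix e :: real assume e: "0 < e"
    define K where "K = \<bar>P $ i $ i + P $ j $ j\<bar> + 1"
    define t where "t = e / K"
    have K: "0 < K" by (simp add: K_def)
    have t: "0 < t" using e K by (simp add: t_def)
    define w :: "real ^ 'n" where "w = axis i 1 + t *\<^sub>R axis j 1"
    have wi: "w $ i = 1" using ij by (simp add: w_def axis_def)
    have "w \<noteq> 0" using wi by auto
    moreover have ax: "(axis i 1 :: real ^ 'n) \<bullet> axis i 1 = 1" for i by (simp add: inner_axis_axis)
    ultimately have *: "2 * (axis i 1 \<bullet> w) * ((P *v axis i 1) \<bullet> w)
        \<le> (P *v axis i 1) \<bullet> axis i 1 * (w \<bullet> w) + (P *v w) \<bullet> w"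
      by (intro two)
    have pe: "(P *v axis k 1) \<bullet> axis l 1 = P $ l $ k" for k l
      by (simp add: matrix_vector_mul_component inner_axis inner_commute[of _ "axis l 1"] inner_axis')
    have ij': "(axis i 1 :: real ^ 'n) \<bullet> axis j 1 = 0" "(axis j 1 :: real ^ 'n) \<bullet> axis i 1 = 0"
      using ij by (simp_all add: inner_axis_axis)
    have 1: "axis i 1 \<bullet> w = 1" by (simp add: w_def inner_add_right ax ij')
    have 2: "(P *v axis i 1) \<bullet> w = P $ i $ i + t * P $ j $ i"
      by (simp add: w_def inner_add_right pe)
    have 3: "w \<bullet> w = 1 + t\<^sup>2"
      by (simp add: w_def inner_add_right inner_add_left ax ij' power2_eq_square)
    have 4: "(P *v w) \<bullet> w = P $ i $ i + t * (P $ i $ j + P $ j $ i) + t\<^sup>2 * P $ j $ j"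
      by (simp add: w_def inner_add_right inner_add_left pe matrix_vector_right_distrib
          matrix_vector_mult_scaleR algebra_simps power2_eq_square)
    have "t * (P $ j $ i - P $ i $ j) \<le> t * (t * (P $ i $ i + P $ j $ j))"
      using * unfolding 1 2 3 4 pe by (simp add: algebra_simps power2_eq_square)
    then have "P $ j $ i - P $ i $ j \<le> t * (P $ i $ i + P $ j $ j)"
      using t by simp
    also have "\<dots> \<le> t * K"
      using t by (intro mult_left_mono) (auto simp: K_def)
    also have "t * K = e" using K by (simp add: t_def)
    finally show "P $ j $ i \<le> P $ i $ j + e" by simp
  qed
  have "P $ j $ i = P $ i $ j" for i j
    by (cases "i = j") (auto intro: antisym le)
  then show "transpose P = P"
    by (simp add: transpose_def vec_eq_iff)
qed

lemma inner_matrix_transpose: "x \<bullet> (A *v y) = (transpose A *v x) \<bullet> (y :: real ^ 'n)"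
  for A :: "real ^ 'n ^ 'm"
  by (simp add: dot_lmul_matrix[symmetric])

text \<open>A zero of a nonnegative quadratic form is a minimum, so the gradient \<open>2 B x\<close> vanishes there:
  otherwise a suitable step from \<open>x\<close> against \<open>y = B x\<close> makes the form negative. Here \<open>t\<close> is the size
  of that step, and the 1 in its denominator covers the case \<open>y \<bullet> B y = 0\<close>.\<close>

lemma psd_kernel:
  fixes B :: "real ^ 'n ^ 'n"
  assumes sym: "transpose B = B" and psd: "\<And>x. 0 \<le> x \<bullet> (B *v x)" and zero: "x \<bullet> (B *v x) = 0"
  shows "B *v x = 0"
proof (rule ccontr)
  define y where "y = B *v x"
  define q where "q = y \<bullet> (B *v y)"
  define t where "t = (y \<bullet> y) / (1 + q)"
  assume "B *v x \<noteq> 0"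
  then have yy: "0 < y \<bullet> y" by (simp add: y_def)
  have q: "0 \<le> q" using psd by (simp add: q_def)
  have t: "0 < t" using yy q by (simp add: t_def add_pos_nonneg)
  have xy: "x \<bullet> y = 0" using zero by (simp add: y_def)
  have "x \<bullet> (B *v y) = y \<bullet> y"
    unfolding inner_matrix_transpose[of x] sym by (simp add: y_def)
  then have "(x - t *\<^sub>R y) \<bullet> (B *v (x - t *\<^sub>R y)) = t * (t * q - 2 * (y \<bullet> y))"
    by (simp add: matrix_vector_mult_diff_distrib matrix_vector_mult_scaleR inner_diff_left
        inner_diff_right xy q_def y_def[symmetric] algebra_simps)
  then have "0 \<le> t * (t * q - 2 * (y \<bullet> y))" using psd by metis
  then have "2 * (y \<bullet> y) \<le> t * q" using t by (simp add: zero_le_mult_iff)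
  also have "t * q \<le> t * (1 + q)" using t by simp
  also have "t * (1 + q) = y \<bullet> y" using q by (simp add: t_def)
  finally show False using yy by simp
qed

text \<open>The polar decomposition, obtained variationally: if \<open>U\<close> maximises \<open>trace (A ** U)\<close> over the
  orthogonal matrices, then \<open>B = A ** U\<close> is symmetric and positive semidefinite, and
  \<open>B ** B = B ** transpose B = A ** transpose A\<close> because \<open>U\<close> cancels. Invertibility of \<open>A\<close> makes \<open>B\<close>
  definite.\<close>

lemma sym_pos_def_root_exists:
  fixes A :: "real ^ 'n ^ 'n"
  assumes "invertible A"
  shows "\<exists>B. sym_pos_def B \<and> B ** B = A ** transpose A"
proof -
  have "continuous_on UNIV (\<lambda>Q :: real ^ 'n ^ 'n. \<Sum>i\<in>UNIV. \<Sum>k\<in>UNIV. A $ i $ k * Q $ k $ i)"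
    by (intro continuous_intros)
  then have "continuous_on {Q. orthogonal_matrix Q} (\<lambda>Q. trace (A ** Q))"
    by (simp add: trace_def matrix_matrix_mult_def) (erule continuous_on_subset, simp)
  moreover have "{Q :: real ^ 'n ^ 'n. orthogonal_matrix Q} \<noteq> {}"
    using orthogonal_matrix_id by auto
  ultimately obtain U where U: "orthogonal_matrix U"
    and max: "\<And>Q. orthogonal_matrix Q \<Longrightarrow> trace (A ** Q) \<le> trace (A ** U)"
    using continuous_attains_sup[OF compact_orthogonal_matrices] by blast
  define B where "B = A ** U"
  have "trace (B ** Q) \<le> trace B" if "orthogonal_matrix Q" for Q
    using max[OF orthogonal_matrix_mul[OF U that]] by (simp add: B_def matrix_mul_assoc)
  note B = trace_maximal_imp_symmetric_psd[OF this]
  have UU: "U ** transpose U = mat 1" using U by (simp add: orthogonal_matrix_def)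
  have "B ** B = B ** transpose B" by (simp add: B)
  also have "\<dots> = A ** (U ** transpose U) ** transpose A"
    by (simp add: B_def matrix_transpose_mul matrix_mul_assoc)
  finally have BB: "B ** B = A ** transpose A" by (simp add: UU)
  have "invertible B"
    unfolding B_def using assms U
    by (intro invertible_mult) (auto simp: orthogonal_matrix_def invertible_def)
  have "0 < x \<bullet> (B *v x)" if "x \<noteq> 0" for x
  proof (rule ccontr)
    assume "\<not> ?thesis"
    then have "x \<bullet> (B *v x) = 0" using B(2)[of x] by simp
    then have "B *v x = 0" using psd_kernel[of B x] B by blast
    then show False
      using \<open>invertible B\<close> that
      by (metis invertible_def matrix_vector_mul_assoc matrix_vector_mul_lid matrix_vector_mult_0_right)
  qed
  then show ?thesis using BB B by (auto simp: sym_pos_def_def)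
qed

text \<open>With \<open>D = B - C\<close>, equality of the squares says \<open>B ** D + D ** C = 0\<close>. Multiplying by \<open>D\<close> and taking
  traces gives \<open>trace (D ** B ** D) + trace (D ** C ** D) = 0\<close>, a vanishing sum of nonnegative terms
  \<open>(D e) \<bullet> B (D e)\<close> and \<open>(D e) \<bullet> C (D e)\<close> over the unit vectors \<open>e\<close>. Definiteness forces \<open>D e = 0\<close>.\<close>

lemma sym_pos_def_root_unique:
  fixes B C :: "real ^ 'n ^ 'n"
  assumes B: "sym_pos_def B" and C: "sym_pos_def C" and eq: "B ** B = C ** C"
  shows "B = C"
proof -
  define D where "D = B - C"
  have tD: "transpose D = D"
    using B C by (simp add: D_def sym_pos_def_def transpose_def vec_eq_iff)
  have "B ** D + D ** C = 0"
    by (simp add: D_def matrix_diff_ldistrib matrix_diff_rdistrib eq)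
  then have "trace (D ** (B ** D + D ** C)) = 0"
    by (simp add: trace_def)
  then have "trace (D ** B ** D) + trace (D ** (D ** C)) = 0"
    by (simp add: matrix_add_ldistrib trace_add matrix_mul_assoc)
  also have "trace (D ** (D ** C)) = trace (D ** C ** D)"
    by (simp add: trace_mul_sym[of D "D ** C"])
  finally have s: "trace (D ** B ** D) + trace (D ** C ** D) = 0" .
  have tr: "trace (D ** S ** D) = (\<Sum>i\<in>UNIV. (D *v axis i 1) \<bullet> (S *v (D *v axis i 1)))" for S
  proof -
    have "(D *v axis i 1) \<bullet> (S *v (D *v axis i 1)) = axis i 1 \<bullet> ((D ** S ** D) *v axis i 1)" for i
      by (simp add: inner_matrix_transpose[of "axis i 1" D] tD flip: matrix_vector_mul_assoc)
    then show ?thesis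
      by (simp add: trace_def inner_axis' matrix_vector_mul_component inner_axis)
  qed
  have nn: "0 \<le> x \<bullet> (S *v x)" if "sym_pos_def S" for x and S :: "real ^ 'n ^ 'n"
    using that by (cases "x = 0") (auto simp: sym_pos_def_def intro: less_imp_le)
  have "(\<Sum>i\<in>UNIV. (D *v axis i 1) \<bullet> (B *v (D *v axis i 1))) = 0"
    using s nn[OF B] nn[OF C] unfolding tr
    by (smt (verit, best) sum_nonneg)
  then have "(D *v axis i 1) \<bullet> (B *v (D *v axis i 1)) = 0" for i
    using nn[OF B] by (subst (asm) sum_nonneg_eq_0_iff) auto
  then have "D *v axis i 1 = 0" for i
    using B unfolding sym_pos_def_def by (metis less_irrefl)
  then have "D = 0"
    by (metis matrix_eq matrix_vector_mult_basis vec_eq_iff column_def vec_lambda_beta zero_index)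
  then show ?thesis by (simp add: D_def)
qed

lemma matrix_sqrt_mult_transpose:
  fixes A :: "real ^ 'n ^ 'n"
  assumes "invertible A"
  shows "sym_pos_def (matrix_sqrt (A ** transpose A))"
    and "matrix_sqrt (A ** transpose A) ** matrix_sqrt (A ** transpose A) = A ** transpose A"
proof -
  have "\<exists>!B. sym_pos_def B \<and> B ** B = A ** transpose A"
    using sym_pos_def_root_exists[OF assms] sym_pos_def_root_unique by metis
  from theI'[OF this] show "sym_pos_def (matrix_sqrt (A ** transpose A))"
    and "matrix_sqrt (A ** transpose A) ** matrix_sqrt (A ** transpose A) = A ** transpose A"
    by (simp_all add: matrix_sqrt_def)
qed

lemma norm_matrix_sqrt:
  fixes A :: "real ^ 'n ^ 'n" and c :: "real ^ 'n"
  assumes "invertible A"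
  defines "S \<equiv> A ** transpose A"
  shows "norm (matrix_sqrt S *v c) = sqrt (c \<bullet> (S *v c))"
    and "c \<noteq> 0 \<Longrightarrow> 0 < norm (matrix_sqrt S *v c)"
proof -
  define B where "B = matrix_sqrt S"
  have B: "sym_pos_def B" "B ** B = S"
    using matrix_sqrt_mult_transpose[OF assms(1)] by (simp_all add: B_def S_def)
  have "transpose B = B" using B(1) by (simp add: sym_pos_def_def)
  then have "c \<bullet> (S *v c) = (norm (B *v c))\<^sup>2"
    unfolding B(2)[symmetric] matrix_vector_mul_assoc[symmetric] inner_matrix_transpose[of c B]
    by (simp add: dot_square_norm)
  then show "norm (matrix_sqrt S *v c) = sqrt (c \<bullet> (S *v c))"
    by (simp add: B_def)
  show "0 < norm (matrix_sqrt S *v c)" if "c \<noteq> 0"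
    using B(1) that by (auto simp: sym_pos_def_def B_def)
qed

section \<open>Linear forms of normal vectors\<close>

abbreviation std_normal_product :: "('n \<Rightarrow> real) measure" where
  "std_normal_product \<equiv> Pi\<^sub>M UNIV (\<lambda>_. std_normal_distribution)"

lemma prob_space_std_normal: "prob_space std_normal_distribution"
  by (rule prob_space_normal_density) simp

lemma prob_space_std_normal_product: "prob_space std_normal_product"
  by (intro prob_space_PiM prob_space_std_normal)

lemma measurable_coordinate [measurable]:
  "(\<lambda>z. z i) \<in> borel_measurable (std_normal_product :: ('n \<Rightarrow> real) measure)"
proof -
  have "(\<lambda>z. z i) \<in> measurable (std_normal_product :: ('n \<Rightarrow> real) measure) std_normal_distribution"
    by measurable
  then show ?thesis by (simp cong: measurable_cong_sets)
qed

lemma distr_coordinate: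
  "distr (std_normal_product :: ('n \<Rightarrow> real) measure) borel (\<lambda>z. z i) = std_normal_distribution"
  using distr_PiM_component[of UNIV "\<lambda>_ :: 'n. std_normal_distribution" i] prob_space_std_normal
  by (simp cong: distr_cong)

lemma indep_vars_coordinates:
  "prob_space.indep_vars (std_normal_product :: ('n \<Rightarrow> real) measure) (\<lambda>_. borel) (\<lambda>i z. z i) UNIV"
proof -
  interpret prob_space "std_normal_product :: ('n \<Rightarrow> real) measure"
    by (rule prob_space_std_normal_product)
  have s: "sets (Pi\<^sub>M UNIV (\<lambda>_ :: 'n. borel :: real measure)) = sets std_normal_product"
    by (intro sets_PiM_cong) simp_all
  show ?thesis
  proof (subst indep_vars_iff_distr_eq_PiM')
    show "distr std_normal_product (Pi\<^sub>M UNIV (\<lambda>_. borel)) (\<lambda>z. \<lambda>i\<in>UNIV. z i)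
        = Pi\<^sub>M UNIV (\<lambda>i :: 'n. distr std_normal_product borel (\<lambda>z. z i))"
      by (simp add: distr_coordinate distr_id2[OF s] restrict_UNIV)
  qed simp_all
qed

lemma coordinate_moments:
  fixes i j :: "'n :: finite"
  shows "integrable std_normal_product (\<lambda>z. z i)" "(\<integral>z. z i \<partial>std_normal_product) = 0"
    and "integrable std_normal_product (\<lambda>z. z i * z j)"
    and "(\<integral>z. z i * z j \<partial>std_normal_product) = (if i = j then 1 else 0)"
proof -
  interpret prob_space "std_normal_product :: ('n \<Rightarrow> real) measure"
    by (rule prob_space_std_normal_product)
  have pow: "integrable std_normal_product (\<lambda>z. z k ^ m)"
    "(\<integral>z. z k ^ m \<partial>std_normal_product) = (\<integral>x. x ^ m \<partial>std_normal_distribution)" for k :: 'n and m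
    using integrable_std_normal_distribution_moment[of m]
      integrable_distr_eq[OF measurable_coordinate[of k], of "\<lambda>x. x ^ m"]
      integral_distr[OF measurable_coordinate[of k], of "\<lambda>x. x ^ m"]
    unfolding distr_coordinate by simp_all
  show int1: "integrable std_normal_product (\<lambda>z. z i)" for i :: 'n
    using pow(1)[of i 1] by simp
  show mean: "(\<integral>z. z i \<partial>std_normal_product) = 0" for i :: 'n
    using pow(2)[of i 1] integral_std_normal_distribution_moment_odd[of 1] by simp
  have ind: "indep_vars (\<lambda>_. borel) (\<lambda>i z. z i) {i, j}"
    by (rule indep_vars_subset[OF indep_vars_coordinates]) simp
  show "integrable std_normal_product (\<lambda>z. z i * z j)"
  proof (cases "i = j")
    case True
    then show ?thesis using pow(1)[of i 2] by (simp add: power2_eq_square)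
  next
    case False
    then show ?thesis
      using indep_vars_integrable[OF _ ind] int1 by simp
  qed
  show "(\<integral>z. z i * z j \<partial>std_normal_product) = (if i = j then 1 else 0)"
  proof (cases "i = j")
    case True
    then show ?thesis
      using pow(2)[of i 2] std_normal_distribution_even_moments(1)[of 1]
      by (simp add: power2_eq_square)
  next
    case False
    then show ?thesis
      using indep_vars_lebesgue_integral[OF _ ind] int1 mean by simp
  qed
qed

text \<open>The convolution theorem for sums of independent normal variables asks for positive standard
  deviations, so the sum is restricted to the coordinates with nonzero coefficient.\<close>

lemma distr_linear_form:
  fixes b :: "real ^ 'n"
  assumes "b \<noteq> 0"
  shows "distr std_normal_product borel (\<lambda>z. b \<bullet> (\<chi> i. z i)) = density lborel (normal_density 0 (norm b))"
proof -
  interpret prob_space "std_normal_product :: ('n \<Rightarrow> real) measure"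
    by (rule prob_space_std_normal_product)
  define I where "I = {i. b $ i \<noteq> 0}"
  have "I \<noteq> {}" using assms by (auto simp: I_def vec_eq_iff)
  have "indep_vars (\<lambda>_. borel) (\<lambda>i z. b $ i * z i) I"
    by (rule indep_vars_compose2[OF indep_vars_subset[OF indep_vars_coordinates]]) simp_all
  moreover have "distributed std_normal_product lborel (\<lambda>z. b $ i * z i) (normal_density 0 \<bar>b $ i\<bar>)"
    if "i \<in> I" for i
  proof -
    have "distributed std_normal_product lborel (\<lambda>z. z i) std_normal_density"
      using distr_coordinate[of i] by (simp add: distributed_def cong: distr_cong)
    from normal_density_affine[OF this, of "b $ i" 0] show ?thesis
      using that by (simp add: I_def)
  qed
  ultimately have "distributed std_normal_product lborel (\<lambda>z. \<Sum>i\<in>I. b $ i * z i)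
      (normal_density (\<Sum>i\<in>I. 0) (sqrt (\<Sum>i\<in>I. \<bar>b $ i\<bar>\<^sup>2)))"
    using \<open>I \<noteq> {}\<close> by (intro sum_indep_normal) (auto simp: I_def)
  moreover have "(\<Sum>i\<in>I. b $ i * z i) = b \<bullet> (\<chi> i. z i)" for z
    unfolding inner_vec_def I_def by (simp, rule sum.mono_neutral_left) auto
  moreover have "sqrt (\<Sum>i\<in>I. \<bar>b $ i\<bar>\<^sup>2) = norm b"
    unfolding norm_vec_def L2_set_def I_def
    by (simp, rule sum.mono_neutral_left) auto
  ultimately show ?thesis
    by (simp add: distributed_def cong: distr_cong)
qed

lemma borel_measurable_vec_lambda:
  fixes f :: "'a \<Rightarrow> 'n :: finite \<Rightarrow> real"
  assumes "\<And>i. (\<lambda>x. f x i) \<in> borel_measurable M"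
  shows "(\<lambda>x. \<chi> i. f x i) \<in> borel_measurable M"
  unfolding borel_measurable_euclidean_space[where 'c = "real ^ 'n"]
  using assms by (auto simp: Basis_vec_def inner_axis)

lemma measurable_linear_image [measurable]:
  "(\<lambda>z. (A :: real ^ 'n ^ 'm) *v (\<chi> i. z i)) \<in> borel_measurable std_normal_product"
  by (intro borel_measurable_continuous_on[OF _ borel_measurable_vec_lambda]
      matrix_vector_mult_linear_continuous_on measurable_coordinate)

text \<open>Mean and covariance determine the affine representation of the law as far as it matters: the
  coordinates of \<open>z\<close> are uncorrelated with mean 0 and variance 1, so the mean is \<open>m\<close> and the
  covariance is \<open>A ** transpose A\<close>.\<close>

lemma covariance_of_centered_normal:
  fixes X :: "'a \<Rightarrow> real ^ 'n" and m :: "real ^ 'n" and A :: "real ^ 'n ^ 'n"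
  assumes X: "X \<in> borel_measurable M"
    and law: "distr M borel X = distr std_normal_product borel (\<lambda>z. m + A *v (\<chi> i. z i))"
    and mean: "mean_vector M X = 0"
  shows "m = 0" and "covariance_matrix M X = A ** transpose A"
proof -
  let ?g = "\<lambda>z. m + A *v (\<chi> i. z i) :: real ^ 'n"
  have g: "?g \<in> borel_measurable std_normal_product" by measurable
  have comp [measurable]: "(\<lambda>x :: real ^ 'n. x $ i) \<in> borel_measurable borel" for i
    by (intro borel_measurable_continuous_onI continuous_intros)
  have transfer: "(\<integral>\<omega>. f (X \<omega>) \<partial>M) = (\<integral>z. f (?g z) \<partial>std_normal_product)"
    if "f \<in> borel_measurable borel" for f :: "real ^ 'n \<Rightarrow> real"
    using integral_distr[OF X that] integral_distr[OF g that] law by simp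
  have entry: "?g z $ i = m $ i + (\<Sum>k\<in>UNIV. A $ i $ k * z k)" for z i
    by (simp add: matrix_vector_mult_def)
  interpret prob_space "std_normal_product :: ('n \<Rightarrow> real) measure"
    by (rule prob_space_std_normal_product)
  have "m $ i = 0" for i
  proof -
    have "0 = (\<integral>\<omega>. X \<omega> $ i \<partial>M)"
      using mean by (simp add: mean_vector_def vec_eq_iff)
    also have "\<dots> = (\<integral>z. ?g z $ i \<partial>std_normal_product)" by (rule transfer) simp
    also have "\<dots> = m $ i"
      unfolding entry by (simp add: coordinate_moments prob_space)
    finally show ?thesis by simp
  qed
  then show m: "m = 0" by (simp add: vec_eq_iff)
  have "(\<integral>\<omega>. X \<omega> $ i * X \<omega> $ j \<partial>M) = (A ** transpose A) $ i $ j" for i j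
  proof -
    have "(\<integral>\<omega>. X \<omega> $ i * X \<omega> $ j \<partial>M) = (\<integral>z. ?g z $ i * ?g z $ j \<partial>std_normal_product)"
      by (rule transfer) simp
    also have "\<dots> = (\<integral>z. (\<Sum>k\<in>UNIV. \<Sum>l\<in>UNIV. (A $ i $ k * A $ j $ l) * (z k * z l)) \<partial>std_normal_product)"
      unfolding entry by (simp add: m sum_product mult_ac)
    also have "\<dots> = (\<Sum>k\<in>UNIV. \<Sum>l\<in>UNIV. (A $ i $ k * A $ j $ l) * (if k = l then 1 else 0))"
      by (simp add: coordinate_moments)
    finally show ?thesis
      by (simp add: matrix_matrix_mult_def transpose_def if_distrib cong: if_cong)
  qed
  then show "covariance_matrix M X = A ** transpose A"
    by (simp add: covariance_matrix_def mean vec_eq_iff)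
qed

text \<open>For \<open>X = A z\<close> in law, \<open>c \<bullet> X\<close> is the linear form of \<open>z\<close> with coefficient vector \<open>transpose A *v c\<close>,
  whose squared norm is \<open>c \<bullet> (S *v c)\<close>. Positivity excludes the point mass at 0, which has no density.\<close>

lemma normal_vector_linear_form:
  fixes X :: "'a \<Rightarrow> real ^ 'n" and c :: "real ^ 'n"
  assumes nv: "normal_vector M X" and mean: "mean_vector M X = 0"
    and cov: "covariance_matrix M X = S" and pos: "0 < c \<bullet> (S *v c)"
  shows "distr M borel (\<lambda>\<omega>. c \<bullet> X \<omega>) = density lborel (normal_density 0 (sqrt (c \<bullet> (S *v c))))"
proof -
  obtain m and A :: "real ^ 'n ^ 'n" where X [measurable]: "X \<in> borel_measurable M"
    and law: "distr M borel X = distr std_normal_product borel (\<lambda>z. m + A *v (\<chi> i. z i))"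
    using nv unfolding normal_vector_def by blast
  note mS = covariance_of_centered_normal[OF X law mean]
  have q: "c \<bullet> (S *v c) = (norm (transpose A *v c))\<^sup>2"
    using mS(2) cov
    by (simp add: matrix_vector_mul_assoc[symmetric] inner_matrix_transpose[of c A] dot_square_norm)
  have "distr M borel (\<lambda>\<omega>. c \<bullet> X \<omega>) = distr (distr M borel X) borel (\<lambda>x. c \<bullet> x)"
    by (simp add: distr_distr comp_def)
  also have "\<dots> = distr std_normal_product borel (\<lambda>z. (transpose A *v c) \<bullet> (\<chi> i. z i))"
    by (simp add: law mS(1) distr_distr comp_def inner_matrix_transpose)
  also have "\<dots> = density lborel (normal_density 0 (norm (transpose A *v c)))"
    using pos q by (intro distr_linear_form) auto
  finally show ?thesis using q by simp
qed

section \<open>Quantiles and tails\<close>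

text \<open>The infimum that defines the quantile is attained because the distribution function is right
  continuous. The bounds on \<open>q\<close> make the set in question nonempty and bounded below.\<close>

lemma cdf_quantile_ge:
  assumes "real_distribution \<mu>" and "0 < q" and "q < 1"
  shows "q \<le> cdf \<mu> (quantile \<mu> q)"
proof -
  interpret real_distribution \<mu> by fact
  let ?S = "{x. q \<le> cdf \<mu> x}"
  have ne: "?S \<noteq> {}"
    using eventually_happens[OF order_tendstoD(1)[OF cdf_lim_at_top_prob \<open>q < 1\<close>]]
    by (auto intro: less_imp_le)
  obtain l where l: "cdf \<mu> l < q"
    using eventually_happens[OF order_tendstoD(2)[OF cdf_lim_at_bot \<open>0 < q\<close>]] by auto
  have bdd: "bdd_below ?S"
  proof (rule bdd_belowI)
    fix x assume "x \<in> ?S"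
    then show "l \<le> x" using l cdf_nondecreasing[of x l] by (cases "x \<le> l") auto
  qed
  have "q \<le> cdf \<mu> y" if less: "quantile \<mu> q < y" for y
  proof -
    obtain x where "x \<in> ?S" "x < y"
      using less cInf_less_iff[OF ne bdd, of y] unfolding quantile_def[symmetric] by blast
    then show ?thesis using cdf_nondecreasing[of x y] by auto
  qed
  then have "eventually (\<lambda>y. q \<le> cdf \<mu> y) (at_right (quantile \<mu> q))"
    by (auto simp: eventually_at_right_field intro: gt_ex)
  then show ?thesis
    using cdf_is_right_cont[of "quantile \<mu> q"]
    by (intro tendsto_lowerbound[of "cdf \<mu>"]) (auto simp: continuous_within)
qed

lemma std_normal_symmetric: "distr std_normal_distribution borel uminus = std_normal_distribution"
proof -
  interpret prob_space std_normal_distribution by (rule prob_space_std_normal)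
  have "distributed std_normal_distribution lborel (\<lambda>x. x) std_normal_density"
    by (simp add: distributed_def distr_id2)
  from normal_density_affine[OF this, of "-1" 0]
  show ?thesis by (simp add: distributed_def cong: distr_cong)
qed

text \<open>The upper tail has mass at most \<open>a / 2\<close> by the choice of the quantile, and the lower tail has the
  same mass by symmetry.\<close>

lemma std_normal_two_sided_tail:
  assumes "0 < a" and "a < 1"
  shows "measure std_normal_distribution {x. quantile std_normal_distribution (1 - a / 2) < \<bar>x\<bar>} \<le> a"
proof -
  interpret real_distribution std_normal_distribution by (rule real_dist_normal_dist)
  define z where "z = quantile std_normal_distribution (1 - a / 2)"
  have "1 - a / 2 \<le> measure std_normal_distribution {..z}"
    using cdf_quantile_ge[OF real_dist_normal_dist, of "1 - a / 2"] assms by (simp add: cdf_def z_def)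
  then have up: "measure std_normal_distribution {z<..} \<le> a / 2"
    using prob_compl[of "{..z}"] by (simp add: Compl_eq_Diff_UNIV[symmetric])
  have "measure std_normal_distribution {..<-z} = measure (distr std_normal_distribution borel uminus) {..<-z}"
    by (simp add: std_normal_symmetric)
  also have "\<dots> = measure std_normal_distribution {z<..}"
    by (subst measure_distr) (auto intro!: arg_cong[where f = "measure _"])
  finally have low: "measure std_normal_distribution {..<-z} \<le> a / 2" using up by simp
  have "measure std_normal_distribution {x. z < \<bar>x\<bar>}
      \<le> measure std_normal_distribution ({z<..} \<union> {..<-z})"
    by (rule finite_measure_mono) auto
  also have "\<dots> \<le> measure std_normal_distribution {z<..} + measure std_normal_distribution {..<-z}"
    by (rule measure_Un_le) auto
  finally show ?thesis using up low by (simp add: z_def)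
qed

lemma normal_two_sided_tail:
  assumes M: "prob_space M" and Y: "Y \<in> borel_measurable M"
    and law: "distr M borel Y = density lborel (normal_density 0 \<sigma>)" and \<sigma>: "0 < \<sigma>"
    and a: "0 < a" "a < 1"
  shows "measure M {\<omega> \<in> space M. quantile std_normal_distribution (1 - a / 2) * \<sigma> < \<bar>Y \<omega>\<bar>} \<le> a"
proof -
  interpret prob_space M by fact
  define z where "z = quantile std_normal_distribution (1 - a / 2)"
  have "distributed M lborel Y (normal_density 0 \<sigma>)"
    using law Y by (simp add: distributed_def cong: distr_cong)
  then have "distributed M lborel (\<lambda>\<omega>. Y \<omega> / \<sigma>) std_normal_density"
    using normal_standard_normal_convert[OF \<sigma>, of Y 0] by simp
  then have std: "distr M borel (\<lambda>\<omega>. Y \<omega> / \<sigma>) = std_normal_distribution"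
    by (simp add: distributed_def cong: distr_cong)
  have "measure M {\<omega> \<in> space M. z * \<sigma> < \<bar>Y \<omega>\<bar>} = measure (distr M borel (\<lambda>\<omega>. Y \<omega> / \<sigma>)) {x. z < \<bar>x\<bar>}"
    using Y \<sigma> by (subst measure_distr) (auto simp: field_simps intro!: arg_cong[where f = "measure M"])
  then show ?thesis
    using std_normal_two_sided_tail[OF a] by (simp add: std z_def)
qed

section \<open>Simultaneous confidence bounds\<close>

text \<open>The union bound over the directions in \<open>C\<close>: only their number enters, whatever the correlation
  between the linear forms.\<close>

lemma simultaneous_confidence:
  fixes X :: "'a \<Rightarrow> real ^ 'n" and S :: "real ^ 'n ^ 'n"
  assumes M: "prob_space M" and nv: "normal_vector M X" and mean: "mean_vector M X = 0"
    and cov: "covariance_matrix M X = S" and inv: "invertible S"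
    and a: "0 < a" "a < 1" and C: "finite C" "0 \<notin> C"
  shows "1 - real (card C) * a \<le> measure M {\<omega> \<in> space M. \<forall>c\<in>C.
    \<bar>c \<bullet> X \<omega>\<bar> \<le> quantile std_normal_distribution (1 - a / 2) * norm (matrix_sqrt S *v c)}"
proof -
  interpret prob_space M by fact
  define z where "z = quantile std_normal_distribution (1 - a / 2)"
  define bad where "bad c = {\<omega> \<in> space M. z * norm (matrix_sqrt S *v c) < \<bar>c \<bullet> X \<omega>\<bar>}" for c
  obtain m and A :: "real ^ 'n ^ 'n" where X [measurable]: "X \<in> borel_measurable M"
    and law: "distr M borel X = distr std_normal_product borel (\<lambda>z. m + A *v (\<chi> i. z i))"
    using nv unfolding normal_vector_def by blast
  have S: "S = A ** transpose A"
    using covariance_of_centered_normal(2)[OF X law mean] cov by simp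
  have A: "invertible A"
    using inv unfolding S invertible_right_inverse by (metis matrix_mul_assoc)
  have bad_le: "measure M (bad c) \<le> a" if "c \<in> C" for c
  proof -
    have c: "0 < norm (matrix_sqrt S *v c)" "norm (matrix_sqrt S *v c) = sqrt (c \<bullet> (S *v c))"
      using norm_matrix_sqrt[OF A, of c] that C S by auto
    then have "distr M borel (\<lambda>\<omega>. c \<bullet> X \<omega>) = density lborel (normal_density 0 (norm (matrix_sqrt S *v c)))"
      using normal_vector_linear_form[OF nv mean cov, of c] by simp
    from normal_two_sided_tail[OF M _ this c(1) a] show ?thesis
      by (simp add: bad_def z_def)
  qed
  have sets: "bad c \<in> sets M" for c unfolding bad_def by measurable
  have "measure M (\<Union>c\<in>C. bad c) \<le> (\<Sum>c\<in>C. measure M (bad c))"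
    by (rule measure_UNION_le) (use C sets in auto)
  also have "\<dots> \<le> real (card C) * a"
    using sum_bounded_above[of C "\<lambda>c. measure M (bad c)" a] bad_le by simp
  finally have "1 - real (card C) * a \<le> measure M (space M - (\<Union>c\<in>C. bad c))"
    using C sets by (subst prob_compl) auto
  also have "space M - (\<Union>c\<in>C. bad c) = {\<omega> \<in> space M. \<forall>c\<in>C. \<bar>c \<bullet> X \<omega>\<bar> \<le> z * norm (matrix_sqrt S *v c)}"
    by (auto simp: bad_def not_less)
  finally show ?thesis by (simp add: z_def)
qed

lemma inner_e_vec: "e_vec i j \<bullet> x = (if i = j then x $ i else x $ i - x $ j)"
  by (simp add: e_vec_def inner_diff_left inner_axis')

lemma e_vec_nonzero: "e_vec i j \<noteq> 0"
proof
  assume "e_vec i j = 0"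
  then have "e_vec i j $ i = 0" by simp
  then show False by (auto simp: e_vec_def axis_def split: if_splits)
qed

lemma e_vec_swap: "i \<noteq> j \<Longrightarrow> e_vec j i = - e_vec i j"
  by (simp add: e_vec_def)

theorem proposition8:
  fixes M :: "'a measure"
    and X :: "'a \<Rightarrow> real ^ 'n"
    and \<Sigma> :: "real ^ 'n ^ 'n"
    and E :: "'n set set"
    and p \<alpha> :: real
    and \<gamma> :: "'n \<Rightarrow> 'n \<Rightarrow> real"
  assumes "prob_space M"
    and "normal_vector M X"
    and "mean_vector M X = 0"
    and "covariance_matrix M X = \<Sigma>"
    and "invertible \<Sigma>"
    and "\<forall>i. \<Sigma> $ i $ i = 1"
    and "\<forall>e\<in>E. card e = 2"
    and "0 < p" and "p < 1"
    and "\<alpha> = p / (real (card E) + real CARD('n))"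
    and "\<forall>i j. {i, j} \<in> E \<or> i = j \<longrightarrow>
           \<gamma> i j = quantile std_normal_distribution (1 - \<alpha> / 2) * norm (matrix_sqrt \<Sigma> *v e_vec i j)"
  shows "measure M {\<omega> \<in> space M. X \<omega> \<in>
           {\<delta>. (\<forall>i. \<bar>\<delta> $ i\<bar> \<le> \<gamma> i i) \<and>
                (\<forall>i j. {i, j} \<in> E \<longrightarrow> \<bar>\<delta> $ i - \<delta> $ j\<bar> \<le> \<gamma> i j)}} \<ge> 1 - p"
proof -
  define z where "z = quantile std_normal_distribution (1 - \<alpha> / 2)"
  let ?ok = "\<lambda>c x. \<bar>c \<bullet> x\<bar> \<le> z * norm (matrix_sqrt \<Sigma> *v c)"
  have \<gamma>: "\<gamma> i j = z * norm (matrix_sqrt \<Sigma> *v e_vec i j)" if "{i, j} \<in> E \<or> i = j" for i j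
    using assms(11)[rule_format, OF that] by (simp add: z_def)
  have edge: "i \<noteq> j" if "{i, j} \<in> E" for i j
    using assms(7) that by fastforce
  have "\<forall>e\<in>E. \<exists>i j. e = {i, j}"
    using assms(7) by (metis card_2_iff)
  then obtain f g where fg: "\<And>e. e \<in> E \<Longrightarrow> e = {f e, g e}" by metis
  \<comment> \<open>Each edge contributes one orientation only: taking both would double the cardinality.\<close>
  define C where "C = range (\<lambda>i. e_vec i i) \<union> (\<lambda>e. e_vec (f e) (g e)) ` E"
  have "card C \<le> CARD('n) + card E"
    unfolding C_def by (intro order_trans[OF card_Un_le] add_mono card_image_le) simp_all
  then have card: "real (card C) \<le> real (card E) + real CARD('n)" by linarith
  have n: "1 \<le> real CARD('n)" using zero_less_card_finite[where 'a = 'n] by linarith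
  then have ge1: "1 \<le> real (card E) + real CARD('n)"
    and pos: "0 < real (card E) + real CARD('n)" by linarith+
  have "0 < \<alpha>" unfolding assms(10) using assms(8) pos by (rule divide_pos_pos)
  moreover have "\<alpha> \<le> p / 1"
    unfolding assms(10) using assms(8) ge1 pos by (intro divide_left_mono) simp_all
  ultimately have \<alpha>: "0 < \<alpha>" "\<alpha> < 1" using assms(9) by auto
  have "real (card C) * \<alpha> \<le> (real (card E) + real CARD('n)) * \<alpha>"
    using card \<alpha> by (intro mult_right_mono) auto
  also have "\<dots> = p" using assms(10) pos by simp
  finally have "1 - p \<le> 1 - real (card C) * \<alpha>" by simp
  also have "\<dots> \<le> measure M {\<omega> \<in> space M. \<forall>c\<in>C. ?ok c (X \<omega>)}"
    unfolding z_def by (rule simultaneous_confidence[OF assms(1-5) \<alpha>])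
      (auto simp: C_def e_vec_nonzero dest: sym)
  finally have bound: "1 - p \<le> measure M {\<omega> \<in> space M. \<forall>c\<in>C. ?ok c (X \<omega>)}" .
  have iff: "(\<forall>c\<in>C. ?ok c x) \<longleftrightarrow> x \<in> {\<delta>. (\<forall>i. \<bar>\<delta> $ i\<bar> \<le> \<gamma> i i) \<and>
      (\<forall>i j. {i, j} \<in> E \<longrightarrow> \<bar>\<delta> $ i - \<delta> $ j\<bar> \<le> \<gamma> i j)}" for x
  proof -
    have node: "?ok (e_vec i i) x \<longleftrightarrow> \<bar>x $ i\<bar> \<le> \<gamma> i i" for i
      by (simp add: \<gamma> inner_e_vec)
    have pair: "?ok (e_vec i j) x \<longleftrightarrow> \<bar>x $ i - x $ j\<bar> \<le> \<gamma> i j" if "{i, j} \<in> E" for i j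
      using edge[OF that] that by (simp add: \<gamma> inner_e_vec)
    have swap: "?ok (e_vec j i) x \<longleftrightarrow> ?ok (e_vec i j) x" if "i \<noteq> j" for i j
      using matrix_vector_mult_scaleR[of "matrix_sqrt \<Sigma>" "-1" "e_vec i j"]
      by (simp add: e_vec_swap[OF that])
    have "?ok (e_vec (f e) (g e)) x \<longleftrightarrow> ?ok (e_vec i j) x" if e: "e \<in> E" "e = {i, j}" for e i j
    proof -
      have "i \<noteq> j" using edge e by blast
      moreover have "{f e, g e} = {i, j}" using fg[OF e(1)] e(2) by simp
      ultimately show ?thesis using swap[of i j] by (auto simp: doubleton_eq_iff)
    qed
    then have "(\<forall>e\<in>E. ?ok (e_vec (f e) (g e)) x) \<longleftrightarrow> (\<forall>i j. {i, j} \<in> E \<longrightarrow> ?ok (e_vec i j) x)"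
      using fg by metis
    then show ?thesis
      using node pair by (simp add: C_def ball_Un)
  qed
  show ?thesis using bound unfolding iff .
qed

end
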